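(* Let $d\ge1$, let $I_1,\dots,I_d\subset\mathbb R$ be intervals, $\mathbf I=I_1\times\dots\times I_d$, and let $X_i$ be an $I_i$-valued random variable with $\mathbb E|X_i|<\infty$ and distribution $\mu_{X_i}$, $i=1,\dots,d$. For each $A\subset\{1,\dots,d\}$ let $Z_{1,A},\dots,Z_{d,A}$ be independent random variables such that $Z_{i,A}$ has distribution $\mu_{X_i}$ if $i\notin A$ and distribution $\delta_{\mathbb E X_i}$ if $i\in A$. Then for every continuous box-$(2,\dots,2)$-convex function $f\colon\mathbf I\to\mathbb R$ (provided the expectations below exist) the Jensen inequality holds: $$\sum_{A\subset\{1,\dots,d\}}(-1)^{|A|}\,\mathbb E f(Z_{1,A},\dots,Z_{d,A})\ge0.$$
   Context: Divided differences: for a real function $g$ of one variable and pairwise distinct points, $[x_0;g]=g(x_0)$ and $[x_0,\dots,x_n;g]=\dfrac{[x_1,\dots,x_n;g]-[x_0,\dots,x_{n-1};g]}{x_n-x_0}$ for $n\ge1$. Multiple divided differences: for $f\colon\mathbf I\to\mathbb R$ and triples $\mathbf x_i=(x_{i0},x_{i1},x_{i2})\in I_i^{3}$ with pairwise distinct coordinates ($i=1,\dots,d$), $[\mathbf x_1;\dots;\mathbf x_d;f]$ is defined by induction on $d$: for $d=1$ it is $[x_{10},x_{11},x_{12};f]$; for $d>1$ it is $[x_{d0},x_{d1},x_{d2};g]$, where $g(x)=[\mathbf x_1;\dots;\mathbf x_{d-1};f(\cdot,\dots,\cdot,x)]$ for $x\in I_d$. $f$ is box-$(2,\dots,2)$-convex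 if $[\mathbf x_1;\dots;\mathbf x_d;f]\ge0$ for all such $\mathbf x_1,\dots,\mathbf x_d$. $\delta_c$ denotes the Dirac measure at $c$. "The expectations exist" means that $f(Z_{1,A},\dots,Z_{d,A})$ is integrable for every $A$. *)

theory Defs
  imports "HOL-Probability.Probability"
begin

text \<open>The divided difference of \<open>g\<close> at the \<open>n + 1\<close> points \<open>x 0, \<dots>, x n\<close>
  (meant for pairwise distinct points).\<close>

primrec divdiff :: "nat \<Rightarrow> (nat \<Rightarrow> real) \<Rightarrow> (real \<Rightarrow> real) \<Rightarrow> real" where
  "divdiff 0 x g = g (x 0)"
| "divdiff (Suc n) x g =
     (divdiff n (\<lambda>k. x (Suc k)) g - divdiff n x g) / (x (Suc n) - x 0)"

text \<open>A function of \<open>d\<close> real variables is represented by a function on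
  \<open>nat \<Rightarrow> real\<close> that is only meaningful on tuples \<open>y \<in> extensional {1..d}\<close>, where
  \<open>y i\<close> is the \<open>i\<close>-th coordinate. The point \<open>x i k\<close> is the \<open>k\<close>-th entry (\<open>k = 0, 1, 2\<close>)
  of the \<open>i\<close>-th triple. The recursion starts at the empty tuple \<open>\<lambda>_. undefined\<close>, so
  that for \<open>d = 1\<close> it gives the ordinary divided difference at three points.\<close>

primrec multi_divdiff :: "nat \<Rightarrow> (nat \<Rightarrow> nat \<Rightarrow> real) \<Rightarrow> ((nat \<Rightarrow> real) \<Rightarrow> real) \<Rightarrow> real" where
  "multi_divdiff 0 x f = f (\<lambda>_. undefined)"
| "multi_divdiff (Suc d) x f =
     divdiff 2 (x (Suc d)) (\<lambda>t. multi_divdiff d x (\<lambda>y. f (y(Suc d := t))))"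

lemma multi_divdiff_1:
  "multi_divdiff 1 x f = divdiff 2 (x 1) (\<lambda>t. f (\<lambda>i\<in>{1}. t))"
proof -
  have "(\<lambda>_. undefined)(Suc 0 := t) = (\<lambda>i\<in>{Suc 0}. t)" for t :: real
    by (auto simp: restrict_def)
  then show ?thesis by simp
qed

text \<open>Box-$(2,\dots,2)$-convexity of \<open>f\<close> on \<open>I 1 \<times> \<dots> \<times> I d\<close>.\<close>

definition box2_convex :: "nat \<Rightarrow> (nat \<Rightarrow> real set) \<Rightarrow> ((nat \<Rightarrow> real) \<Rightarrow> real) \<Rightarrow> bool" where
  "box2_convex d I f \<longleftrightarrow>
     (\<forall>x. (\<forall>i\<in>{1..d}. x i \<in> {0..2} \<rightarrow> I i \<and> inj_on (x i) {0..2}) \<longrightarrow>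
        multi_divdiff d x f \<ge> 0)"

end

theory Submission
  imports Defs
begin

text \<open>
  Integrate over the last coordinate last. For fixed \<open>t\<close>, let \<open>\<Phi> t\<close> be the alternating sum of the
  integrals of the sections \<open>y \<mapsto> f (y(d + 1 := t))\<close>. Applying the statement for \<open>d\<close> coordinates to
  a second divided difference of \<open>f\<close> in the last coordinate shows that \<open>\<Phi>\<close> has nonnegative
  second divided differences on the set of those \<open>t\<close> for which the sections are integrable. By
  Fubini this set contains almost every \<open>t\<close> as well as the mean, so the one-dimensional
  Jensen inequality for \<open>\<Phi>\<close>, proved with a supporting line at the mean, gives the step to \<open>d + 1\<close>.
\<close>

section \<open>Divided differences: linearity and exchange with integrals\<close>

lemma divdiff_diff: "divdiff n x (\<lambda>t. f t - g t) = divdiff n x f - divdiff n x g"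
  by (induction n arbitrary: x) (simp_all add: diff_divide_distrib)

lemma divdiff_divide: "divdiff n x (\<lambda>t. f t / c) = divdiff n x f / c"
  by (induction n arbitrary: x) (simp_all add: diff_divide_distrib mult.commute)

lemma divdiff_cong: "(\<And>k. k \<le> n \<Longrightarrow> f (x k) = g (x k)) \<Longrightarrow> divdiff n x f = divdiff n x g"
proof (induction n arbitrary: x)
  case (Suc n)
  from Suc.IH[of x] Suc.IH[of "\<lambda>k. x (Suc k)"] Suc.prems show ?case by simp
qed simp

lemma divdiff_sum:
  "divdiff n x (\<lambda>t. \<Sum>b\<in>B. c b * f b t) = (\<Sum>b\<in>B. c b * divdiff n x (f b))"
  by (induction n arbitrary: x)
    (simp_all add: right_diff_distrib diff_divide_distrib sum_subtractf sum_divide_distrib)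

lemma divdiff_2:
  "divdiff 2 x f =
     ((f (x 2) - f (x 1)) / (x 2 - x 1) - (f (x 1) - f (x 0)) / (x 1 - x 0)) / (x 2 - x 0)"
  by (simp add: numeral_2_eq_2)

lemma integrable_divdiff:
  assumes "\<And>k. k \<le> n \<Longrightarrow> integrable M (f (x k))"
  shows "integrable M (\<lambda>y. divdiff n x (\<lambda>t. f t y))"
  using assms by (induction n arbitrary: x) simp_all

text \<open>A divided difference is a finite linear combination of the values at its nodes, so
  integrability at these \<open>n + 1\<close> nodes suffices. This matters because sections of a
  function on the product will be known to be integrable only for almost every parameter and at the
  mean.\<close>

lemma integral_divdiff:
  fixes f :: "real \<Rightarrow> 'a \<Rightarrow> real"
  assumes "\<And>k. k \<le> n \<Longrightarrow> integrable M (f (x k))"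
  shows "(\<integral>y. divdiff n x (\<lambda>t. f t y) \<partial>M) = divdiff n x (\<lambda>t. \<integral>y. f t y \<partial>M)"
  using assms
proof (induction n arbitrary: x)
  case (Suc n)
  have "integrable M (\<lambda>y. divdiff n x (\<lambda>t. f t y))"
    "integrable M (\<lambda>y. divdiff n (\<lambda>k. x (Suc k)) (\<lambda>t. f t y))"
    using Suc.prems by (auto intro!: integrable_divdiff)
  with Suc.IH[of x] Suc.IH[of "\<lambda>k. x (Suc k)"] Suc.prems show ?case by simp
qed simp

section \<open>Multiple divided differences and box convexity\<close>

lemma multi_divdiff_diff:
  "multi_divdiff d x (\<lambda>y. f y - g y) = multi_divdiff d x f - multi_divdiff d x g"
  by (induction d arbitrary: f g) (simp_all add: divdiff_diff)

lemma multi_divdiff_divide: "multi_divdiff d x (\<lambda>y. f y / c) = multi_divdiff d x f / c"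
  by (induction d arbitrary: f) (simp_all add: divdiff_divide)

text \<open>Both operations are finite linear combinations of values, hence they commute. The
  recursion puts the last coordinate outermost; this exchange moves it innermost.\<close>

lemma multi_divdiff_divdiff:
  "multi_divdiff d x (\<lambda>y. divdiff n p (\<lambda>t. f t y)) = divdiff n p (\<lambda>t. multi_divdiff d x (f t))"
  by (induction n arbitrary: p) (simp_all add: multi_divdiff_diff multi_divdiff_divide)

text \<open>Only the values on the finite grid spanned by the nodes enter. Hence \<open>f\<close>
  may be changed off the box, and \<open>x\<close> at indices outside \<open>{1..d}\<close>.\<close>

lemma multi_divdiff_cong:
  assumes "\<And>i. i \<in> {1..d} \<Longrightarrow> x i = x' i"
    and "\<And>y. y \<in> (\<Pi>\<^sub>E i\<in>{1..d}. x i ` {0..2}) \<Longrightarrow> f y = g y"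
  shows "multi_divdiff d x f = multi_divdiff d x' g"
  using assms
proof (induction d arbitrary: f g)
  case 0
  show ?case using 0(2)[of "\<lambda>_. undefined"] by simp
next
  case (Suc d)
  have upd: "y(Suc d := x (Suc d) k) \<in> (\<Pi>\<^sub>E i\<in>{1..Suc d}. x i ` {0..2})"
    if "k \<le> 2" "y \<in> (\<Pi>\<^sub>E i\<in>{1..d}. x i ` {0..2})" for k y
    using that by (auto simp: PiE_iff extensional_def le_Suc_eq)
  have "multi_divdiff d x (\<lambda>y. f (y(Suc d := x (Suc d) k))) =
      multi_divdiff d x' (\<lambda>y. g (y(Suc d := x (Suc d) k)))" if "k \<le> 2" for k
  proof (rule Suc.IH)
    show "x i = x' i" if "i \<in> {1..d}" for i
      using Suc.prems(1) that by simp
    show "f (y(Suc d := x (Suc d) k)) = g (y(Suc d := x (Suc d) k))"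
      if "y \<in> (\<Pi>\<^sub>E i\<in>{1..d}. x i ` {0..2})" for y
      by (rule Suc.prems(2)[OF upd[OF \<open>k \<le> 2\<close> that]])
  qed
  moreover have "x' (Suc d) = x (Suc d)"
    using Suc.prems(1)[of "Suc d"] by simp
  ultimately show ?case
    by (auto intro: divdiff_cong)
qed

lemma box2_convex_cong:
  assumes "\<And>y. y \<in> (\<Pi>\<^sub>E i\<in>{1..d}. I i) \<Longrightarrow> f y = g y"
  shows "box2_convex d I f \<longleftrightarrow> box2_convex d I g"
proof -
  have "multi_divdiff d x f = multi_divdiff d x g"
    if "\<forall>i\<in>{1..d}. x i \<in> {0..2} \<rightarrow> I i \<and> inj_on (x i) {0..2}" for x
  proof (rule multi_divdiff_cong)
    fix y assume "y \<in> (\<Pi>\<^sub>E i\<in>{1..d}. x i ` {0..2})"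
    then have "y \<in> (\<Pi>\<^sub>E i\<in>{1..d}. I i)"
      by (rule subsetD[OF PiE_mono, rotated]) (use that in auto)
    then show "f y = g y" by (rule assms)
  qed simp
  then show ?thesis
    unfolding box2_convex_def by auto
qed

text \<open>Fix the last triple of a \<open>(d + 1)\<close>-fold difference to \<open>p\<close> and
  exchange the order of the differences. The resulting functions of \<open>d\<close> variables are
  those to which the induction hypothesis will be applied.\<close>

lemma box2_convex_Suc_divdiff:
  assumes "box2_convex (Suc d) I f" "p \<in> {0..2} \<rightarrow> I (Suc d)" "inj_on p {0..2}"
  shows "box2_convex d I (\<lambda>y. divdiff 2 p (\<lambda>t. f (y(Suc d := t))))"
  unfolding box2_convex_def
proof (intro allI impI)
  fix x :: "nat \<Rightarrow> nat \<Rightarrow> real"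
  assume x: "\<forall>i\<in>{1..d}. x i \<in> {0..2} \<rightarrow> I i \<and> inj_on (x i) {0..2}"
  have "multi_divdiff (Suc d) (x(Suc d := p)) f \<ge> 0"
    using assms x by (intro assms(1)[unfolded box2_convex_def, rule_format]) (auto simp: le_Suc_eq)
  moreover have "multi_divdiff (Suc d) (x(Suc d := p)) f =
      divdiff 2 p (\<lambda>t. multi_divdiff d x (\<lambda>y. f (y(Suc d := t))))"
    by (auto intro!: divdiff_cong multi_divdiff_cong)
  ultimately show "multi_divdiff d x (\<lambda>y. divdiff 2 p (\<lambda>t. f (y(Suc d := t)))) \<ge> 0"
    by (simp add: multi_divdiff_divdiff)
qed

section \<open>Jensen's inequality in one variable\<close>

text \<open>Chord slopes ending at the mean \<open>m\<close> are at most those starting there, so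
  the supremum of the former is the slope of a supporting line, which is then integrated.
  \<open>G\<close> is a general set because it will consist of the points with integrable sections,
  which need not be all of an interval.\<close>

lemma (in prob_space) jensen_divdiff:
  fixes X :: "'a \<Rightarrow> real" and \<phi> :: "real \<Rightarrow> real"
  assumes X: "integrable M X" and \<phi>: "integrable M (\<lambda>\<omega>. \<phi> (X \<omega>))"
    and G: "AE \<omega> in M. X \<omega> \<in> G" "expectation X \<in> G"
    and nonneg: "\<And>p. p \<in> {0..2} \<rightarrow> G \<Longrightarrow> inj_on p {0..2} \<Longrightarrow> divdiff 2 p \<phi> \<ge> 0"
  shows "\<phi> (expectation X) \<le> expectation (\<lambda>\<omega>. \<phi> (X \<omega>))"
proof -
  define m where "m = expectation X"
  have slope: "(\<phi> m - \<phi> x) / (m - x) \<le> (\<phi> y - \<phi> m) / (y - m)"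
    if "x \<in> G" "y \<in> G" "x < m" "m < y" for x y
  proof -
    define p :: "nat \<Rightarrow> real" where "p k = (if k = 0 then x else if k = 1 then m else y)" for k
    have "divdiff 2 p \<phi> \<ge> 0"
      using that G by (intro nonneg) (auto simp: p_def m_def inj_on_def)
    with that show ?thesis
      by (auto simp: divdiff_2 p_def zero_le_divide_iff)
  qed
  show ?thesis
  \<comment> \<open>For almost surely constant \<open>X\<close>, the set \<open>G\<close> may miss
    one side of \<open>m\<close>, and then the supremum of left slopes used below need not make
    sense.\<close>
  proof (cases "AE \<omega> in M. X \<omega> = m")
    case True
    then have "AE \<omega> in M. \<phi> (X \<omega>) = \<phi> m" by auto
    then have "expectation (\<lambda>\<omega>. \<phi> (X \<omega>)) = expectation (\<lambda>_. \<phi> m)"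
      using \<phi> by (intro integral_cong_AE) auto
    then show ?thesis by (simp add: m_def prob_space)
  next
    case False
    \<comment> \<open>Without such a point, \<open>X - m\<close> would be nonnegative almost
      everywhere with mean zero, hence zero almost everywhere.\<close>
    have "\<exists>x\<in>G. x < m"
    proof (rule ccontr)
      assume "\<not> ?thesis"
      then have ge: "AE \<omega> in M. 0 \<le> X \<omega> - m"
        using G(1) by (auto simp: not_less elim!: eventually_mono)
      have "expectation (\<lambda>\<omega>. X \<omega> - m) = 0"
        using X by (simp add: m_def prob_space)
      then have "AE \<omega> in M. X \<omega> - m = 0"
        using X ge by (subst (asm) integral_nonneg_eq_0_iff_AE) auto
      then have "AE \<omega> in M. X \<omega> = m"
        by (rule eventually_mono) simp
      with False show False by contradiction
    qed
    moreover have "\<exists>y\<in>G. m < y"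
    proof (rule ccontr)
      assume "\<not> ?thesis"
      then have ge: "AE \<omega> in M. 0 \<le> m - X \<omega>"
        using G(1) by (auto simp: not_less elim!: eventually_mono)
      have "expectation (\<lambda>\<omega>. m - X \<omega>) = 0"
        using X by (simp add: m_def prob_space)
      then have "AE \<omega> in M. m - X \<omega> = 0"
        using X ge by (subst (asm) integral_nonneg_eq_0_iff_AE) auto
      then have "AE \<omega> in M. X \<omega> = m"
        by (rule eventually_mono) simp
      with False show False by contradiction
    qed
    ultimately obtain a b where ab: "a \<in> G" "a < m" "b \<in> G" "m < b" by blast
    \<comment> \<open>The point \<open>a\<close> makes \<open>S\<close> nonempty, and the slope of
      the chord from \<open>m\<close> to \<open>b\<close> bounds it from above.\<close>
    define S where "S = (\<lambda>x. (\<phi> m - \<phi> x) / (m - x)) ` {x\<in>G. x < m}"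
    have bdd: "bdd_above S"
      using slope ab by (auto simp: S_def bdd_above_def)
    have line: "\<phi> m + Sup S * (x - m) \<le> \<phi> x" if "x \<in> G" for x
    proof (cases x m rule: linorder_cases)
      case less
      with that bdd have "(\<phi> m - \<phi> x) / (m - x) \<le> Sup S"
        by (intro cSup_upper) (auto simp: S_def)
      with less show ?thesis by (simp add: divide_le_eq algebra_simps)
    next
      case greater
      with that ab slope have "Sup S \<le> (\<phi> x - \<phi> m) / (x - m)"
        by (intro cSup_least) (auto simp: S_def)
      with greater show ?thesis by (simp add: le_divide_eq algebra_simps)
    qed simp
    have "expectation (\<lambda>\<omega>. \<phi> m + Sup S * (X \<omega> - m)) \<le> expectation (\<lambda>\<omega>. \<phi> (X \<omega>))"
      using X \<phi> G(1) line by (intro integral_mono_AE) auto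
    moreover have "expectation (\<lambda>\<omega>. \<phi> m + Sup S * (X \<omega> - m)) = \<phi> m"
      using X by (simp add: m_def prob_space)
    ultimately show ?thesis by (simp add: m_def)
  qed
qed

section \<open>Splitting off one coordinate of a product measure\<close>

text \<open>The map \<open>(t, y) \<mapsto> y(j := t)\<close> pushes the product of
  \<open>M j\<close> and \<open>PiM J M\<close> forward to the product over
  \<open>insert j J\<close>, so Fubini for pairs applies.\<close>

lemma integral_PiM_insert:
  fixes f :: "('i \<Rightarrow> 'a) \<Rightarrow> real"
  assumes prob: "\<And>i. i \<in> insert j J \<Longrightarrow> prob_space (M i)"
    and f: "integrable (PiM (insert j J) M) f"
  shows "AE t in M j. integrable (PiM J M) (\<lambda>y. f (y(j := t)))" (is ?ae)
    and "integrable (M j) (\<lambda>t. \<integral>y. f (y(j := t)) \<partial>PiM J M)" (is ?int)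
    and "(\<integral>y. f y \<partial>PiM (insert j J) M) = (\<integral>t. \<integral>y. f (y(j := t)) \<partial>PiM J M \<partial>M j)" (is ?eq)
proof -
  interpret Mj: prob_space "M j" by (simp add: prob)
  interpret PJ: prob_space "PiM J M" by (intro prob_space_PiM prob) auto
  interpret pair_prob_space "M j" "PiM J M" ..
  have distr: "distr (M j \<Otimes>\<^sub>M PiM J M) (PiM (insert j J) M) (\<lambda>(t, y). y(j := t)) =
      PiM (insert j J) M"
    by (intro distr_pair_PiM_eq_PiM prob) auto
  have meas: "(\<lambda>(t, y). y(j := t)) \<in> M j \<Otimes>\<^sub>M PiM J M \<rightarrow>\<^sub>M PiM (insert j J) M"
    unfolding case_prod_beta by (rule measurable_fun_upd[where J = J]) auto
  have int: "integrable (M j \<Otimes>\<^sub>M PiM J M) (\<lambda>(t, y). f (y(j := t)))"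
    using f by (subst (asm) distr[symmetric], subst (asm) integrable_distr_eq[OF meas])
      (simp_all add: case_prod_beta')
  show ?ae ?int
    using AE_integrable_fst'[OF int] integrable_fst'[OF int] by simp_all
  show ?eq
    using integral_fst'[OF int] f
    by (subst distr[symmetric], subst integral_distr[OF meas]) (simp_all add: case_prod_beta')
qed

text \<open>For an arbitrary predicate \<open>P\<close>, the argument passes to the event
  \<open>t \<noteq> m\<close>, which is measurable because points are closed.\<close>

lemma AE_returnD:
  assumes "AE t in return borel (m :: 'a :: t1_space). P t"
  shows "P m"
proof (rule ccontr)
  assume "\<not> P m"
  have "AE t in return borel m. t \<noteq> m"
    using assms by (rule eventually_mono) (use \<open>\<not> P m\<close> in auto)
  then show False by (subst (asm) AE_return) auto
qed

section \<open>The inequality for product measures\<close>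

text \<open>With \<open>\<mu> i\<close> the law of \<open>X i\<close>, this is the law prescribed
  for \<open>Z i A\<close> in the theorem.\<close>

definition mean_at :: "nat set \<Rightarrow> (nat \<Rightarrow> real measure) \<Rightarrow> nat \<Rightarrow> real measure" where
  "mean_at A \<mu> i = (if i \<in> A then return borel (\<integral>x. x \<partial>\<mu> i) else \<mu> i)"

text \<open>Laws in place of random variables let coordinates be split off one at a time. The
  induction keeps \<open>f\<close> arbitrary, since its hypothesis is applied to a divided
  difference of \<open>f\<close>.\<close>

lemma jensen_box2_convex_PiM:
  assumes "\<And>i. i \<in> {1..d} \<Longrightarrow> prob_space (\<mu> i)"
    and "\<And>i. i \<in> {1..d} \<Longrightarrow> sets (\<mu> i) = sets borel"
    and "\<And>i. i \<in> {1..d} \<Longrightarrow> AE x in \<mu> i. x \<in> I i"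
    and "\<And>i. i \<in> {1..d} \<Longrightarrow> integrable (\<mu> i) (\<lambda>x. x)"
    and "\<And>i. i \<in> {1..d} \<Longrightarrow> (\<integral>x. x \<partial>\<mu> i) \<in> I i"
    and "\<And>A. A \<subseteq> {1..d} \<Longrightarrow> integrable (\<Pi>\<^sub>M i\<in>{1..d}. mean_at A \<mu> i) f"
    and "box2_convex d I f"
  shows "(\<Sum>A\<in>Pow {1..d}. (-1) ^ card A * (\<integral>y. f y \<partial>(\<Pi>\<^sub>M i\<in>{1..d}. mean_at A \<mu> i))) \<ge> 0"
  using assms
proof (induction d arbitrary: f)
  \<comment> \<open>Only \<open>A = {}\<close> occurs, and the product measure is concentrated on
    the empty tuple, so the sum is \<open>multi_divdiff 0 x f\<close>.\<close>
  case 0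
  then show ?case
    by (simp add: PiM_empty integral_return box2_convex_def lebesgue_integral_count_space_finite)
next
  case (Suc d)
  let ?n = "Suc d"
  define m where "m = (\<integral>x. x \<partial>\<mu> ?n)"
  define P where "P B = (\<Pi>\<^sub>M i\<in>{1..d}. mean_at B \<mu> i)" for B
  define F where "F B = (\<lambda>t. \<integral>y. f (y(?n := t)) \<partial>P B)" for B
  \<comment> \<open>Off \<open>G\<close> some integral in \<open>\<Phi>\<close> takes the default
    value 0 of a non-integrable function, so nothing can be said about \<open>\<Phi>\<close>
    there.\<close>
  define G where "G = {t \<in> I ?n. \<forall>B\<in>Pow {1..d}. integrable (P B) (\<lambda>y. f (y(?n := t)))}"
  define \<Phi> where "\<Phi> t = (\<Sum>B\<in>Pow {1..d}. (-1) ^ card B * F B t)" for t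
  interpret prob_space "\<mu> ?n" by (simp add: Suc.prems)
  have insert: "{1..?n} = insert ?n {1..d}" by auto
  have prob: "prob_space (mean_at A \<mu> i)" if "i \<in> {1..?n}" for A i
    using Suc.prems(1)[OF that] by (auto simp: mean_at_def intro: prob_space_return)
  have int: "integrable (Pi\<^sub>M (insert ?n {1..d}) (mean_at A \<mu>)) f" if "A \<subseteq> {1..?n}" for A
    using Suc.prems(6)[OF that] by (simp only: insert eta_contract_eq)

  \<comment> \<open>If the last index is not in the set, the last coordinate keeps its law.\<close>
  have sections: "AE t in \<mu> ?n. integrable (P B) (\<lambda>y. f (y(?n := t)))"
      "integrable (\<mu> ?n) (F B)"
      "(\<integral>y. f y \<partial>(\<Pi>\<^sub>M i\<in>{1..?n}. mean_at B \<mu> i)) = (\<integral>t. F B t \<partial>\<mu> ?n)"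
    if "B \<subseteq> {1..d}" for B
  proof -
    have B: "B \<subseteq> {1..?n}" "mean_at B \<mu> ?n = \<mu> ?n"
      using that by (auto simp: mean_at_def)
    note * = integral_PiM_insert[of ?n "{1..d}" "mean_at B \<mu>" f, OF prob int[OF B(1)], folded insert, unfolded B(2)]
    show "AE t in \<mu> ?n. integrable (P B) (\<lambda>y. f (y(?n := t)))"
      "integrable (\<mu> ?n) (F B)"
      "(\<integral>y. f y \<partial>(\<Pi>\<^sub>M i\<in>{1..?n}. mean_at B \<mu> i)) = (\<integral>t. F B t \<partial>\<mu> ?n)"
      using * by (simp_all add: P_def F_def)
  qed
  \<comment> \<open>If the last index is in the set, the last coordinate has the Dirac law at
    \<open>m\<close>. Integrability of almost every section then means integrability of the section
    at \<open>m\<close> itself.\<close>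
  have section_mean: "integrable (P B) (\<lambda>y. f (y(?n := m)))"
      "(\<integral>y. f y \<partial>(\<Pi>\<^sub>M i\<in>{1..?n}. mean_at (insert ?n B) \<mu> i)) = F B m"
    if "B \<subseteq> {1..d}" for B
  proof -
    have B: "insert ?n B \<subseteq> {1..?n}" "mean_at (insert ?n B) \<mu> ?n = return borel m"
      using that by (auto simp: mean_at_def m_def)
    have P: "Pi\<^sub>M {1..d} (mean_at (insert ?n B) \<mu>) = P B"
      unfolding P_def by (intro PiM_cong) (auto simp: mean_at_def)
    note * = integral_PiM_insert[of ?n "{1..d}" "mean_at (insert ?n B) \<mu>" f,
      OF prob int[OF B(1)], folded insert, unfolded P B(2), folded F_def]
    show "integrable (P B) (\<lambda>y. f (y(?n := m)))"
      by (rule AE_returnD[OF *(1)])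
    have "F B \<in> borel_measurable borel"
      using *(2) by (auto dest: borel_measurable_integrable)
    then show "(\<integral>y. f y \<partial>(\<Pi>\<^sub>M i\<in>{1..?n}. mean_at (insert ?n B) \<mu> i)) = F B m"
      using *(3) by (simp add: integral_return)
  qed

  have "\<Phi> m \<le> (\<integral>t. \<Phi> t \<partial>\<mu> ?n)"
    unfolding m_def
  proof (rule jensen_divdiff)
    show "integrable (\<mu> ?n) (\<lambda>x. x)" by (simp add: Suc.prems)
    show "integrable (\<mu> ?n) \<Phi>"
      unfolding \<Phi>_def using sections(2) by auto
    show "AE t in \<mu> ?n. t \<in> G"
    proof -
      have "AE t in \<mu> ?n. \<forall>B\<in>Pow {1..d}. integrable (P B) (\<lambda>y. f (y(?n := t)))"
        using sections(1) by (intro AE_finite_allI) auto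
      moreover have "AE t in \<mu> ?n. t \<in> I ?n"
        by (rule Suc.prems(3)) simp
      ultimately show ?thesis
        by eventually_elim (simp add: G_def)
    qed
    show "expectation (\<lambda>x. x) \<in> G"
      using Suc.prems(5)[of ?n] section_mean(1) by (auto simp: G_def m_def)
    fix p assume p: "p \<in> {0..2} \<rightarrow> G" "inj_on p {0..2 :: nat}"
    \<comment> \<open>The nodes of \<open>p\<close> lie in \<open>G\<close>, so \<open>h\<close> is
      integrable and its alternating sum of integrals is the divided difference of
      \<open>\<Phi>\<close>.\<close>
    define h where "h y = divdiff 2 p (\<lambda>t. f (y(?n := t)))" for y
    have G: "integrable (P B) (\<lambda>y. f (y(?n := p k)))" if "B \<subseteq> {1..d}" "k \<le> 2" for B k
      using p(1) that by (auto simp: G_def Pi_iff)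
    have "box2_convex d I h"
      unfolding h_def using Suc.prems(7) p by (intro box2_convex_Suc_divdiff) (auto simp: G_def)
    moreover have "integrable (P B) h" if "B \<subseteq> {1..d}" for B
      unfolding h_def using G[OF that] by (intro integrable_divdiff)
    ultimately have "0 \<le> (\<Sum>B\<in>Pow {1..d}. (-1) ^ card B * (\<integral>y. h y \<partial>P B))"
      unfolding P_def using Suc.prems by (intro Suc.IH) auto
    also have "\<dots> = (\<Sum>B\<in>Pow {1..d}. (-1) ^ card B * divdiff 2 p (F B))"
      unfolding h_def F_def using G by (intro sum.cong refl arg_cong2[where f = "(*)"] integral_divdiff) auto
    also have "\<dots> = divdiff 2 p \<Phi>"
      unfolding \<Phi>_def by (rule divdiff_sum[symmetric])
    finally show "divdiff 2 p \<Phi> \<ge> 0" .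
  qed
  also have "(\<integral>t. \<Phi> t \<partial>\<mu> ?n) = (\<Sum>B\<in>Pow {1..d}. (-1) ^ card B * (\<integral>t. F B t \<partial>\<mu> ?n))"
    unfolding \<Phi>_def using sections(2) by (subst Bochner_Integration.integral_sum) auto
  finally have le: "\<Phi> m \<le> \<dots>" .

  \<comment> \<open>Split the subsets by whether they contain the last index; inserting it flips the
    sign, so the second half contributes \<open>- \<Phi> m\<close>.\<close>
  let ?T = "\<lambda>A. (-1) ^ card A * (\<integral>y. f y \<partial>(\<Pi>\<^sub>M i\<in>{1..?n}. mean_at A \<mu> i))"
  have inj: "inj_on (Set.insert ?n) (Pow {1..d})"
    by (rule inj_on_inverseI[where g = "\<lambda>A. A - {?n}"]) auto
  have "(\<Sum>A\<in>Pow {1..?n}. ?T A) = (\<Sum>B\<in>Pow {1..d}. ?T B) + (\<Sum>B\<in>Pow {1..d}. ?T (Set.insert ?n B))"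
    unfolding insert Pow_insert
    by (subst sum.union_disjoint) (auto simp: sum.reindex[OF inj[simplified]])
  also have "(\<Sum>B\<in>Pow {1..d}. ?T B) = (\<Sum>B\<in>Pow {1..d}. (-1) ^ card B * (\<integral>t. F B t \<partial>\<mu> ?n))"
    using sections(3) by (intro sum.cong) auto
  also have "(\<Sum>B\<in>Pow {1..d}. ?T (Set.insert ?n B)) = - \<Phi> m"
    unfolding \<Phi>_def sum_negf[symmetric]
  proof (intro sum.cong refl)
    fix B assume B: "B \<in> Pow {1..d}"
    then have "finite B" "?n \<notin> B" by (auto intro: finite_subset)
    then show "?T (Set.insert ?n B) = - ((-1) ^ card B * F B m)"
      using B section_mean(2)[of B] by simp
  qed
  finally show ?case using le by simp
qed

section \<open>Passage from product measures to random variables\<close>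

text \<open>A point outside an interval lies strictly to one side of all its points, and strict
  monotonicity of the expectation excludes this for the mean.\<close>

lemma (in prob_space) expectation_in_interval:
  fixes X :: "'a \<Rightarrow> real"
  assumes S: "is_interval S" and X: "integrable M X" "AE \<omega> in M. X \<omega> \<in> S"
  shows "expectation X \<in> S"
proof (rule ccontr)
  assume notin: "expectation X \<notin> S"
  have "(\<forall>s\<in>S. s < expectation X) \<or> (\<forall>s\<in>S. expectation X < s)"
    using S notin unfolding is_interval_1 by (metis linorder_not_le order_less_imp_le)
  then show False
  proof
    assume *: "\<forall>s\<in>S. s < expectation X"
    have "expectation X < expectation X"
      using * by (intro expectation_less X(1) eventually_mono[OF X(2)]) blast
    then show False by simp
  next
    assume *: "\<forall>s\<in>S. expectation X < s"
    have "expectation X < expectation X"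
      using * by (intro expectation_greater X(1) eventually_mono[OF X(2)]) blast
    then show False by simp
  qed
qed

text \<open>Continuity refers to the product topology on all functions. For a countable index type
  its Borel sets form the product sigma-algebra, into which the tuples over \<open>J\<close> embed
  measurably.\<close>

lemma borel_measurable_PiM_indicator_continuous_on:
  fixes f :: "('i :: countable \<Rightarrow> 'a :: {second_countable_topology, t1_space}) \<Rightarrow> real"
  assumes "\<And>i. i \<in> J \<Longrightarrow> S i \<in> sets borel" "continuous_on (\<Pi>\<^sub>E i\<in>J. S i) f"
  shows "(\<lambda>y. indicator (\<Pi>\<^sub>E i\<in>J. S i) y * f y) \<in> borel_measurable (\<Pi>\<^sub>M i\<in>J. borel)"
proof -
  let ?S = "\<Pi>\<^sub>E i\<in>J. S i"
  have id: "(\<lambda>y. y) \<in> (\<Pi>\<^sub>M i\<in>J. borel) \<rightarrow>\<^sub>M (borel :: ('i \<Rightarrow> 'a) measure)"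
  proof -
    have "(\<lambda>y i. y i) \<in> (\<Pi>\<^sub>M i\<in>J. borel) \<rightarrow>\<^sub>M (\<Pi>\<^sub>M i\<in>UNIV. borel :: 'a measure)"
    proof (rule measurable_PiM_single')
      fix i show "(\<lambda>y. y i) \<in> (\<Pi>\<^sub>M i\<in>J. borel) \<rightarrow>\<^sub>M (borel :: 'a measure)"
      proof (cases "i \<in> J")
        \<comment> \<open>Outside \<open>J\<close> every tuple has the constant value
          \<open>undefined\<close>.\<close>
        case False
        then have "(\<lambda>y. y i) \<in> (\<Pi>\<^sub>M i\<in>J. borel) \<rightarrow>\<^sub>M (borel :: 'a measure) \<longleftrightarrow>
            (\<lambda>y. undefined) \<in> (\<Pi>\<^sub>M i\<in>J. borel :: 'a measure) \<rightarrow>\<^sub>M (borel :: 'a measure)"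
          by (intro measurable_cong) (auto simp: space_PiM PiE_iff extensional_def)
        then show ?thesis by simp
      qed simp
    qed auto
    then show ?thesis
      using measurable_cong_sets[OF refl sets_PiM_equal_borel] by blast
  qed
  \<comment> \<open>A countable intersection of cylinders; \<open>{undefined}\<close> is closed, so
    each of them is Borel.\<close>
  have cl: "?S = (\<Inter>i. {y. y i \<in> (if i \<in> J then S i else {undefined})})"
    by (auto simp: PiE_def extensional_def split: if_splits)
  have "?S \<in> sets borel"
    unfolding cl
  proof (intro sets.countable_INT'')
    fix i
    have "(\<lambda>y :: 'i \<Rightarrow> 'a. y i) \<in> borel_measurable borel"
      by (intro borel_measurable_continuous_onI continuous_on_product_coordinates)
    moreover have "(if i \<in> J then S i else {undefined}) \<in> sets borel"
      using assms(1) by auto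
    ultimately have "(\<lambda>y :: 'i \<Rightarrow> 'a. y i) -` (if i \<in> J then S i else {undefined}) \<inter> space borel \<in> sets borel"
      by (rule measurable_sets)
    then show "{y :: 'i \<Rightarrow> 'a. y i \<in> (if i \<in> J then S i else {undefined})} \<in> sets borel"
      by (simp add: vimage_def)
  qed auto
  from borel_measurable_continuous_on_indicator[OF this assms(2)]
  have "(\<lambda>y. indicator ?S y * f y) \<in> borel_measurable borel" by simp
  from measurable_compose[OF id this] show ?thesis .
qed

theorem theorem53:
  fixes d :: nat
    and I :: "nat \<Rightarrow> real set"
    and M :: "nat \<Rightarrow> 'a measure" and X :: "nat \<Rightarrow> 'a \<Rightarrow> real"
    and N :: "nat set \<Rightarrow> 'b measure" and Z :: "nat \<Rightarrow> nat set \<Rightarrow> 'b \<Rightarrow> real"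
    and f :: "(nat \<Rightarrow> real) \<Rightarrow> real"
  assumes "d \<ge> 1"
    and "\<And>i. i \<in> {1..d} \<Longrightarrow> is_interval (I i)"
    and "\<And>i. i \<in> {1..d} \<Longrightarrow> prob_space (M i)"
    and "\<And>i. i \<in> {1..d} \<Longrightarrow> X i \<in> space (M i) \<rightarrow> I i"
    and "\<And>i. i \<in> {1..d} \<Longrightarrow> integrable (M i) (X i)"
    and "\<And>A. A \<subseteq> {1..d} \<Longrightarrow> prob_space (N A)"
    and "\<And>A. A \<subseteq> {1..d} \<Longrightarrow>
           prob_space.indep_vars (N A) (\<lambda>_. borel) (\<lambda>i. Z i A) {1..d}"
    and "\<And>A i. A \<subseteq> {1..d} \<Longrightarrow> i \<in> {1..d} - A \<Longrightarrow>
           distr (N A) borel (Z i A) = distr (M i) borel (X i)"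
    and "\<And>A i. A \<subseteq> {1..d} \<Longrightarrow> i \<in> A \<Longrightarrow>
           distr (N A) borel (Z i A) = return borel (\<integral>\<omega>. X i \<omega> \<partial>M i)"
    and "continuous_on (\<Pi>\<^sub>E i\<in>{1..d}. I i) f"
    and "box2_convex d I f"
    and "\<And>A. A \<subseteq> {1..d} \<Longrightarrow> integrable (N A) (\<lambda>\<omega>. f (\<lambda>i\<in>{1..d}. Z i A \<omega>))"
  shows "(\<Sum>A\<in>Pow {1..d}. (-1) ^ card A * (\<integral>\<omega>. f (\<lambda>i\<in>{1..d}. Z i A \<omega>) \<partial>N A)) \<ge> 0"
proof -
  define \<mu> where "\<mu> i = distr (M i) borel (X i)" for i
  \<comment> \<open>Continuity constrains \<open>f\<close> only on the box. The truncation
    \<open>g\<close> is measurable on the whole product and agrees with \<open>f\<close> where it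
    matters.\<close>
  define g where "g y = indicator (\<Pi>\<^sub>E i\<in>{1..d}. I i) y * f y" for y
  have X: "X i \<in> borel_measurable (M i)" if "i \<in> {1..d}" for i
    using assms(5)[OF that] by simp
  have I: "I i \<in> sets borel" if "i \<in> {1..d}" for i
    using assms(2)[OF that] by (rule real_interval_borel_measurable)
  have g: "g \<in> borel_measurable (\<Pi>\<^sub>M i\<in>{1..d}. borel)"
    unfolding g_def using I assms(10)
    by (intro borel_measurable_PiM_indicator_continuous_on) auto
  have mean: "(\<integral>x. x \<partial>\<mu> i) = (\<integral>\<omega>. X i \<omega> \<partial>M i)" if "i \<in> {1..d}" for i
    unfolding \<mu>_def using X[OF that] by (simp add: integral_distr)
  have AE_\<mu>: "AE x in \<mu> i. x \<in> I i" if "i \<in> {1..d}" for i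
    unfolding \<mu>_def using assms(4)[OF that] X[OF that] I[OF that]
    by (subst AE_distr_iff) auto
  have mean_I: "(\<integral>x. x \<partial>\<mu> i) \<in> I i" if "i \<in> {1..d}" for i
    unfolding mean[OF that] using assms(4)[OF that]
    by (intro prob_space.expectation_in_interval assms(2,3,5) that) auto

  have Z: "integrable (\<Pi>\<^sub>M i\<in>{1..d}. mean_at A \<mu> i) g"
    "(\<integral>y. g y \<partial>(\<Pi>\<^sub>M i\<in>{1..d}. mean_at A \<mu> i)) = (\<integral>\<omega>. f (\<lambda>i\<in>{1..d}. Z i A \<omega>) \<partial>N A)"
    if A: "A \<subseteq> {1..d}" for A
  proof -
    interpret prob_space "N A" using A by (rule assms(6))
    let ?Z = "\<lambda>\<omega>. \<lambda>i\<in>{1..d}. Z i A \<omega>"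
    have rv: "Z i A \<in> borel_measurable (N A)" if "i \<in> {1..d}" for i
      using assms(7)[OF A] that by (simp add: indep_vars_def)
    have distr_Z: "distr (N A) borel (Z i A) = mean_at A \<mu> i" if "i \<in> {1..d}" for i
      using assms(8,9)[OF A, of i] that mean[OF that] by (auto simp: mean_at_def \<mu>_def)
    have meas: "?Z \<in> N A \<rightarrow>\<^sub>M (\<Pi>\<^sub>M i\<in>{1..d}. borel)"
      using rv by (intro measurable_restrict)
    have "(\<Pi>\<^sub>M i\<in>{1..d}. mean_at A \<mu> i) = (\<Pi>\<^sub>M i\<in>{1..d}. distr (N A) borel (Z i A))"
      using distr_Z by (intro PiM_cong) auto
    \<comment> \<open>Independence says that the joint law is the product of the marginals. The
      criterion asks for a nonempty index set, and here \<open>d \<ge> 1\<close> enters.\<close>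
    also have "\<dots> = distr (N A) (\<Pi>\<^sub>M i\<in>{1..d}. borel) ?Z"
      using assms(1) rv assms(7)[OF A] by (subst (asm) indep_vars_iff_distr_eq_PiM') auto
    finally have PiM: "(\<Pi>\<^sub>M i\<in>{1..d}. mean_at A \<mu> i) = \<dots>" .
    \<comment> \<open>\<open>Z i A\<close> is given only through its law, so it lies in
      \<open>I i\<close> almost surely; for \<open>i \<in> A\<close> this is the fact that the mean
      belongs to the interval.\<close>
    have "AE \<omega> in N A. Z i A \<omega> \<in> I i" if i: "i \<in> {1..d}" for i
    proof -
      have "AE x in mean_at A \<mu> i. x \<in> I i"
      proof (cases "i \<in> A")
        case True
        have "Measurable.pred borel (\<lambda>x. x \<in> I i)"
          using I[OF i] by (simp add: pred_def)
        with True show ?thesis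
          using mean_I[OF i] unfolding mean_at_def by (simp add: AE_return)
      next
        case False
        with AE_\<mu>[OF i] show ?thesis unfolding mean_at_def by simp
      qed
      then show ?thesis
        unfolding distr_Z[OF i, symmetric] using rv[OF i] I[OF i]
        by (subst (asm) AE_distr_iff) auto
    qed
    then have "AE \<omega> in N A. \<forall>i\<in>{1..d}. Z i A \<omega> \<in> I i"
      by (subst AE_ball_countable) auto
    then have AE: "AE \<omega> in N A. g (?Z \<omega>) = f (?Z \<omega>)"
      by eventually_elim (auto simp: g_def indicator_def)
    have f: "integrable (N A) (\<lambda>\<omega>. f (?Z \<omega>))"
      using A by (rule assms(12))
    have gZ: "(\<lambda>\<omega>. g (?Z \<omega>)) \<in> borel_measurable (N A)"
      using measurable_compose[OF meas g] .
    show "integrable (\<Pi>\<^sub>M i\<in>{1..d}. mean_at A \<mu> i) g"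
      unfolding PiM integrable_distr_eq[OF meas g]
      using integrable_cong_AE[OF gZ _ AE] f by auto
    show "(\<integral>y. g y \<partial>(\<Pi>\<^sub>M i\<in>{1..d}. mean_at A \<mu> i)) = (\<integral>\<omega>. f (?Z \<omega>) \<partial>N A)"
      unfolding PiM integral_distr[OF meas g]
      using integral_cong_AE[OF gZ _ AE] f by auto
  qed

  have "box2_convex d I g"
    using assms(11) by (subst box2_convex_cong[of _ _ _ f]) (auto simp: g_def)
  then have "(\<Sum>A\<in>Pow {1..d}. (-1) ^ card A * (\<integral>y. g y \<partial>(\<Pi>\<^sub>M i\<in>{1..d}. mean_at A \<mu> i))) \<ge> 0"
  proof (rule jensen_box2_convex_PiM[rotated -1])
    fix i assume i: "i \<in> {1..d}"
    show "prob_space (\<mu> i)"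
      unfolding \<mu>_def using prob_space.prob_space_distr[OF assms(3)[OF i] X[OF i]] .
    show "sets (\<mu> i) = sets borel"
      by (simp add: \<mu>_def)
    show "integrable (\<mu> i) (\<lambda>x. x)"
      unfolding \<mu>_def using assms(5)[OF i] X[OF i] by (subst integrable_distr_eq) auto
  qed (use AE_\<mu> mean_I Z(1) in auto)
  also have "(\<Sum>A\<in>Pow {1..d}. (-1) ^ card A * (\<integral>y. g y \<partial>(\<Pi>\<^sub>M i\<in>{1..d}. mean_at A \<mu> i))) =
      (\<Sum>A\<in>Pow {1..d}. (-1) ^ card A * (\<integral>\<omega>. f (\<lambda>i\<in>{1..d}. Z i A \<omega>) \<partial>N A))"
    using Z(2) by (intro sum.cong) auto
  finally show ?thesis .
qed

end
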